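(* Every Hausdorff, locally compact topological space is $T$-locally compact.
   Context: A topological space $X$ is called $T$-locally compact at $x \in X$ if for every open set $U$ containing $x$ there exists an open subset $V$ of $X$ containing $x$ such that the boundary $\partial V$ is compact and $V \subseteq U$. The space $X$ is called $T$-locally compact if it is $T$-locally compact at each of its points. *)

theory Defs
  imports "HOL-Analysis.Analysis"
begin

definition T_locally_compact_at :: "'a topology \<Rightarrow> 'a \<Rightarrow> bool"
  where "T_locally_compact_at X x \<longleftrightarrow>
    (\<forall>U. openin X U \<and> x \<in> U \<longrightarrow>
      (\<exists>V. openin X V \<and> x \<in> V \<and> compactin X (X frontier_of V) \<and> V \<subseteq> U))"

definition T_locally_compact_space :: "'a topology \<Rightarrow> bool"
  where "T_locally_compact_space X \<longleftrightarrow> (\<forall>x \<in> topspace X. T_locally_compact_at X x)"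

end

theory Submission
  imports Defs
begin

text \<open>A locally compact Hausdorff space is regular, so its compact neighbourhoods can be shrunk
  into any open set: they form a neighbourhood base. Inside an open set \<open>U\<close> around \<open>x\<close>, take an
  open \<open>V\<close> and a compact \<open>K\<close> with \<open>x \<in> V \<subseteq> K \<subseteq> U\<close>. In a Hausdorff space \<open>K\<close> is closed, so it
  contains the closure of \<open>V\<close> and with it the boundary of \<open>V\<close>; the boundary, being closed in a
  compact set, is compact.\<close>

theorem lemma4:
  fixes X :: "'a topology"
  assumes "Hausdorff_space X"
    and "locally_compact_space X"
  shows "T_locally_compact_space X"
  unfolding T_locally_compact_space_def T_locally_compact_at_def
proof (intro ballI allI impI)
  fix x U
  assume U: "openin X U \<and> x \<in> U"
  have "neighbourhood_base_of (compactin X) X"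
    using assms locally_compact_space_neighbourhood_base by blast
  then obtain V K where V: "openin X V" "x \<in> V" "V \<subseteq> K" and K: "compactin X K" "K \<subseteq> U"
    using U unfolding neighbourhood_base_of by meson
  have "closedin X K"
    using assms(1) K(1) by (rule compactin_imp_closedin)
  then have "X frontier_of V \<subseteq> K"
    using closure_of_minimal[OF V(3)] by (auto simp: frontier_of_def)
  then have "compactin X (X frontier_of V)"
    using K(1) closedin_frontier_of closed_compactin by blast
  then show "\<exists>V. openin X V \<and> x \<in> V \<and> compactin X (X frontier_of V) \<and> V \<subseteq> U"
    using V K(2) by blast
qed

end
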